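(* Let $M$ be a matroid with rank function $r$. Then $M$ is a fundamental transversal matroid if and only if $$\sum_{Y\in\mathcal{F}}\beta(Y)=r(M)-r\Bigl(\bigcap_{X\in\mathcal{F}}X\Bigr)$$ for all filters $\mathcal{F}\subseteq\mathcal{Z}(M)$.
   Context: Matroids have finite ground sets; $E(M)$ is the ground set of $M$. A set $X\subseteq E(M)$ is cyclic if it is a union of circuits of $M$ (the empty set is cyclic). $\mathcal{Z}(M)$ is the set of all cyclic flats of $M$, ordered by inclusion. A filter in $\mathcal{Z}(M)$ is a subset $\mathcal{F}\subseteq\mathcal{Z}(M)$ such that if $A\in\mathcal{F}$, $B\in\mathcal{Z}(M)$ and $A\subseteq B$, then $B\in\mathcal{F}$. The intersection of the empty family is $E(M)$. The function $\beta$ is defined recursively on all subsets $X$ of $E(M)$ by $$\beta(X)=r(M)-r(X)-\sum_{Y\in\mathcal{Z}(M):\,X\subset Y}\beta(Y),$$ where $\subset$ denotes proper inclusion. A set system on a set $S$ is a finite multiset $(A_1,\ldots,A_s)$ of subsets of $S$. A partial transversal of it is a subset $I\subseteq S$ for which there is an injection $\phi:I\to\{1,\ldots,s\}$ with $x\in A_{\phi(x)}$ for all $x\in I$. The partial transversals are the independent sets of a matroid on $S$; such a matroid is called transversal and the set system is a presentation of it. A fundamental transversal matroid is a transversal matroid that has a presentation $(A_1,\ldots,A_s)$ for which no difference $A_i-\bigcup_{j\ne i}A_j$, for $1\le i\le s$, is empty. (Equivalently, $M$ is a matroid having a fundamental basis, that is, a basis $B$ such that each $F\in\mathcal{Z}(M)$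 is spanned by $B\cap F$.) *)

theory Defs
  imports Main
begin

locale matroid =
  fixes E :: "'a set" and indep :: "'a set \<Rightarrow> bool"
  assumes finite_ground: "finite E"
    and indep_subset_ground: "indep I \<Longrightarrow> I \<subseteq> E"
    and indep_empty: "indep {}"
    and indep_mono: "indep J \<Longrightarrow> I \<subseteq> J \<Longrightarrow> indep I"
    and indep_augment: "indep I \<Longrightarrow> indep J \<Longrightarrow> card I < card J \<Longrightarrow> \<exists>x \<in> J - I. indep (insert x I)"
begin

definition rank :: "'a set \<Rightarrow> nat" where
  "rank X = Max (card ` {I. I \<subseteq> X \<and> indep I})"

definition circuit :: "'a set \<Rightarrow> bool" where
  "circuit C \<longleftrightarrow> C \<subseteq> E \<and> \<not> indep C \<and> (\<forall>D. D \<subset> C \<longrightarrow> indep D)"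

definition cyclic :: "'a set \<Rightarrow> bool" where
  "cyclic X \<longleftrightarrow> (\<exists>\<C>. (\<forall>C \<in> \<C>. circuit C) \<and> X = \<Union>\<C>)"

definition flat :: "'a set \<Rightarrow> bool" where
  "flat F \<longleftrightarrow> F \<subseteq> E \<and> (\<forall>x \<in> E - F. rank F < rank (insert x F))"

definition cyclic_flats :: "'a set set" where
  "cyclic_flats = {F. flat F \<and> cyclic F}"

definition cyclic_flats_filter :: "'a set set \<Rightarrow> bool" where
  "cyclic_flats_filter \<F> \<longleftrightarrow> \<F> \<subseteq> cyclic_flats \<and>
     (\<forall>A \<in> \<F>. \<forall>B \<in> cyclic_flats. A \<subseteq> B \<longrightarrow> B \<in> \<F>)"

function beta :: "'a set \<Rightarrow> int" where
  "beta X = int (rank E) - int (rank X) - (\<Sum>Y \<in> {Y \<in> cyclic_flats. X \<subset> Y}. beta Y)"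
  by pat_completeness auto
termination
proof (relation "measure (\<lambda>X. card (E - X))", goal_cases)
  case (2 X Y)
  then have "Y \<subseteq> E" "X \<subset> Y"
    by (auto simp: cyclic_flats_def flat_def)
  then have "E - Y \<subset> E - X"
    by blast
  then show ?case
    by (simp add: finite_ground psubset_card_mono)
qed simp

declare beta.simps [simp del]

end

text \<open>A set system \<open>(A\<^sub>1, \<dots>, A\<^sub>s)\<close> is a list of sets: members may repeat,
  and the order plays no role in the definitions below. Indices start at 0.\<close>

definition set_system :: "'a set \<Rightarrow> 'a set list \<Rightarrow> bool" where
  "set_system S As \<longleftrightarrow> (\<forall>A \<in> set As. A \<subseteq> S)"

definition partial_transversal :: "'a set \<Rightarrow> 'a set list \<Rightarrow> 'a set \<Rightarrow> bool" where
  "partial_transversal S As I \<longleftrightarrow> I \<subseteq> S \<and>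
     (\<exists>\<phi>. inj_on \<phi> I \<and> \<phi> ` I \<subseteq> {..<length As} \<and> (\<forall>x \<in> I. x \<in> As ! \<phi> x))"

context matroid
begin

definition presentation :: "'a set list \<Rightarrow> bool" where
  "presentation As \<longleftrightarrow> set_system E As \<and> (\<forall>I. indep I \<longleftrightarrow> partial_transversal E As I)"

definition fundamental_transversal :: bool where
  "fundamental_transversal \<longleftrightarrow>
     (\<exists>As. presentation As \<and>
       (\<forall>i < length As. As ! i - (\<Union>j \<in> {..<length As} - {i}. As ! j) \<noteq> {}))"

end

end

theory Submission
  imports Defs
begin

text \<open>
  Both sides are equivalent to the existence of a fundamental basis \<open>B\<close>. Given \<open>B\<close>, each
  \<open>b \<in> B\<close> has a largest cyclic flat \<open>Y b\<close> avoiding it, \<open>\<beta>(F)\<close> counts the \<open>b\<close> with \<open>Y b = F\<close>,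
  and a filter \<open>\<F>\<close> contains \<open>Y b\<close> exactly when \<open>b\<close> lies outside \<open>\<Inter>\<F>\<close>; moreover \<open>\<Inter>\<F>\<close> is
  spanned by its intersection with \<open>B\<close>. Conversely, the filter identities allow one to choose,
  for each cyclic flat \<open>F\<close>, a set of \<open>\<beta>(F)\<close> elements that is independent over \<open>F\<close> and lies in
  every cyclic flat not contained in \<open>F\<close>; the union of these sets is a fundamental basis.
  A fundamental basis gives a presentation by the sets \<open>E - span (B - {b})\<close>, and conversely the
  private elements of a fundamental presentation form a fundamental basis.
\<close>

section \<open>Hall's marriage theorem and partial transversals\<close>

text \<open>Induction on the number of elements to be matched. A tight nonempty proper subset is
  matched first and the rest outside its neighbours; if there is none, every other inequality has
  slack and any single pair may be fixed first.\<close>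

theorem hall_marriage:
  fixes N :: "'a \<Rightarrow> 'b set"
  assumes "finite I" and "\<And>x. x \<in> I \<Longrightarrow> finite (N x)"
    and "\<And>J. J \<subseteq> I \<Longrightarrow> card J \<le> card (\<Union>(N ` J))"
  shows "\<exists>\<phi>. inj_on \<phi> I \<and> (\<forall>x\<in>I. \<phi> x \<in> N x)"
  using assms
proof (induction "card I" arbitrary: I N rule: less_induct)
  case less
  show ?case
  proof (cases "I = {}")
    case True
    then show ?thesis by simp
  next
    case False
    note fin = less.prems(2) and hc = less.prems(3)
    have finU: "finite (\<Union>(N ` J))" if "J \<subseteq> I" for J
      using that fin \<open>finite I\<close> by (meson finite_UN_I finite_subset subsetD)
    show ?thesis
    proof (cases "\<exists>J. J \<noteq> {} \<and> J \<subset> I \<and> card (\<Union>(N ` J)) = card J")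
      case True
      then obtain J where J: "J \<noteq> {}" "J \<subset> I" "card (\<Union>(N ` J)) = card J" by blast
      have finJ: "finite J" using J(2) \<open>finite I\<close> finite_subset by blast
      have "card J < card I" using J(2) \<open>finite I\<close> by (simp add: psubset_card_mono)
      then have "\<exists>\<phi>. inj_on \<phi> J \<and> (\<forall>x\<in>J. \<phi> x \<in> N x)"
        using less.hyps[of J N] J(2) fin hc finJ by (meson psubset_imp_subset subset_trans subsetD)
      then obtain \<phi> where \<phi>: "inj_on \<phi> J" "\<forall>x\<in>J. \<phi> x \<in> N x" by blast
      define N' where "N' x = N x - \<Union>(N ` J)" for x
      have "card (I - J) < card I"
        using J \<open>finite I\<close> by (intro psubset_card_mono) auto
      \<comment> \<open>Hall's condition survives the removal of the neighbours of \<open>J\<close>: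
        it is applied to \<open>L \<union> J\<close> and the tight equality for \<open>J\<close> is
        subtracted.\<close>
      moreover have "card L \<le> card (\<Union>(N' ` L))" if L: "L \<subseteq> I - J" for L
      proof -
        have finL: "finite L" using L \<open>finite I\<close> finite_subset by blast
        have "card L + card J = card (L \<union> J)"
          using L finL finJ by (subst card_Un_disjoint) auto
        also have "\<dots> \<le> card (\<Union>(N ` (L \<union> J)))" using L J(2) by (intro hc) auto
        also have "\<Union>(N ` (L \<union> J)) = \<Union>(N' ` L) \<union> \<Union>(N ` J)" by (auto simp: N'_def)
        also have "card \<dots> \<le> card (\<Union>(N' ` L)) + card (\<Union>(N ` J))" by (rule card_Un_le)
        finally show ?thesis using J(3) by simp
      qed
      ultimately have "\<exists>\<psi>. inj_on \<psi> (I - J) \<and> (\<forall>x\<in>I - J. \<psi> x \<in> N' x)"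
        using \<open>finite I\<close> fin by (intro less.hyps) (auto simp: N'_def)
      then obtain \<psi> where \<psi>: "inj_on \<psi> (I - J)" "\<forall>x\<in>I - J. \<psi> x \<in> N' x" by blast
      have ne: "\<phi> x \<noteq> \<psi> y" if "x \<in> J" "y \<in> I - J" for x y
        using that \<phi>(2) \<psi>(2) by (auto simp: N'_def)
      have "inj_on (\<lambda>x. if x \<in> J then \<phi> x else \<psi> x) I"
      proof (rule inj_onI)
        fix x y assume "x \<in> I" "y \<in> I"
          and "(if x \<in> J then \<phi> x else \<psi> x) = (if y \<in> J then \<phi> y else \<psi> y)"
        then show "x = y"
          using inj_onD[OF \<phi>(1), of x y] inj_onD[OF \<psi>(1), of x y] ne[of x y] ne[of y x]
          by (auto split: if_splits)
      qed
      moreover have "\<forall>x\<in>I. (if x \<in> J then \<phi> x else \<psi> x) \<in> N x"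
        using \<phi>(2) \<psi>(2) by (auto simp: N'_def)
      ultimately show ?thesis by blast
    next
      case nontight: False
      obtain x where x: "x \<in> I" using False by blast
      have "card {x} \<le> card (N x)" using hc[of "{x}"] x by simp
      then have "N x \<noteq> {}" by auto
      then obtain y where y: "y \<in> N x" by blast
      define N' where "N' z = N z - {y}" for z
      have "card (I - {x}) < card I"
        using x \<open>finite I\<close> by (intro psubset_card_mono) auto
      moreover have "card L \<le> card (\<Union>(N' ` L))" if L: "L \<subseteq> I - {x}" for L
      proof (cases "L = {}")
        case False
        have "L \<subset> I" using L x by blast
        then have "card L < card (\<Union>(N ` L))"
          using nontight False hc[of L] by (metis nat_less_le psubset_imp_subset)
        moreover have "\<Union>(N' ` L) = \<Union>(N ` L) - {y}" by (auto simp: N'_def)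
        moreover have "card (\<Union>(N ` L)) - 1 \<le> card (\<Union>(N ` L) - {y})"
          using finU[of L] \<open>L \<subset> I\<close> by (simp add: card_Diff_singleton_if)
        ultimately show ?thesis by simp
      qed simp
      ultimately have "\<exists>\<psi>. inj_on \<psi> (I - {x}) \<and> (\<forall>z\<in>I - {x}. \<psi> z \<in> N' z)"
        using \<open>finite I\<close> fin by (intro less.hyps) (auto simp: N'_def)
      then obtain \<psi> where \<psi>: "inj_on \<psi> (I - {x})" "\<forall>z\<in>I - {x}. \<psi> z \<in> N' z" by blast
      have "inj_on (\<psi>(x := y)) I"
        using \<psi> by (auto simp: inj_on_def N'_def)
      moreover have "\<forall>z\<in>I. (\<psi>(x := y)) z \<in> N z"
        using \<psi>(2) y by (auto simp: N'_def)
      ultimately show ?thesis by blast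
    qed
  qed
qed

lemma partial_transversal_card_le:
  assumes "partial_transversal S As I"
  shows "card I \<le> card {i. i < length As \<and> As ! i \<inter> I \<noteq> {}}"
proof -
  obtain \<phi> where \<phi>: "inj_on \<phi> I" "\<phi> ` I \<subseteq> {..<length As}" "\<forall>x\<in>I. x \<in> As ! \<phi> x"
    using assms unfolding partial_transversal_def by blast
  have "card I = card (\<phi> ` I)" using \<phi>(1) by (simp add: card_image)
  also have "\<dots> \<le> card {i. i < length As \<and> As ! i \<inter> I \<noteq> {}}"
    using \<phi>(2,3) by (intro card_mono) auto
  finally show ?thesis .
qed

lemma partial_transversal_mono:
  assumes "partial_transversal S As I" and "J \<subseteq> I"
  shows "partial_transversal S As J"
proof -
  obtain \<phi> where \<phi>: "inj_on \<phi> I" "\<phi> ` I \<subseteq> {..<length As}" "\<forall>x\<in>I. x \<in> As ! \<phi> x" "I \<subseteq> S"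
    using assms(1) unfolding partial_transversal_def by blast
  show ?thesis
    unfolding partial_transversal_def
  proof (intro conjI exI)
    show "J \<subseteq> S" using assms(2) \<phi>(4) by (rule subset_trans)
    show "inj_on \<phi> J" using \<phi>(1) assms(2) by (rule inj_on_subset)
    show "\<phi> ` J \<subseteq> {..<length As}" using image_mono[OF assms(2)] \<phi>(2) by (rule subset_trans)
    show "\<forall>x\<in>J. x \<in> As ! \<phi> x" using \<phi>(3) assms(2) by blast
  qed
qed

text \<open>Elements are matched to list positions rather than to sets, so that equal members of the
  system count separately in Hall's theorem.\<close>

lemma partial_transversalI_hall:
  assumes "I \<subseteq> S" and "finite I"
    and "\<And>J. J \<subseteq> I \<Longrightarrow> card J \<le> card {i. i < length As \<and> As ! i \<inter> J \<noteq> {}}"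
  shows "partial_transversal S As I"
proof -
  have "\<exists>\<phi>. inj_on \<phi> I \<and> (\<forall>x\<in>I. \<phi> x \<in> {i. i < length As \<and> x \<in> As ! i})"
  proof (rule hall_marriage)
    fix J assume "J \<subseteq> I"
    have "{i. i < length As \<and> As ! i \<inter> J \<noteq> {}} = (\<Union>x\<in>J. {i. i < length As \<and> x \<in> As ! i})"
      by auto
    then show "card J \<le> card (\<Union>x\<in>J. {i. i < length As \<and> x \<in> As ! i})"
      using assms(3)[OF \<open>J \<subseteq> I\<close>] by simp
  qed (use assms(2) in auto)
  then show ?thesis using assms(1) unfolding partial_transversal_def by auto
qed

context matroid
begin

section \<open>Rank function of a matroid\<close>

lemma finite_indep: "indep I \<Longrightarrow> finite I"
  using finite_ground finite_subset indep_subset_ground by blast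

lemma finite_indep_subsets: "finite {I. I \<subseteq> X \<and> indep I}"
  by (rule finite_subset[of _ "Pow E"]) (use finite_ground indep_subset_ground in auto)

lemma card_le_rank: "indep I \<Longrightarrow> I \<subseteq> X \<Longrightarrow> card I \<le> rank X"
  unfolding rank_def by (rule Max_ge) (use finite_indep_subsets in auto)

lemma rank_attained: obtains I where "indep I" "I \<subseteq> X" "card I = rank X"
proof -
  have "rank X \<in> card ` {I. I \<subseteq> X \<and> indep I}"
    unfolding rank_def by (rule Max_in) (use finite_indep_subsets indep_empty in auto)
  then show thesis using that by auto
qed

lemma indep_extend:
  assumes "indep I" and "I \<subseteq> X"
  obtains J where "indep J" "I \<subseteq> J" "J \<subseteq> X" "card J = rank X"
proof -
  have "\<exists>J. indep J \<and> I \<subseteq> J \<and> J \<subseteq> X \<and> card J = rank X"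
    using assms
  proof (induction "rank X - card I" arbitrary: I rule: less_induct)
    case less
    show ?case
    proof (cases "card I = rank X")
      case True
      then show ?thesis using less.prems by blast
    next
      case False
      then have lt: "card I < rank X" using card_le_rank[OF less.prems] by simp
      obtain K where K: "indep K" "K \<subseteq> X" "card K = rank X" by (rule rank_attained)
      obtain x where x: "x \<in> K - I" "indep (insert x I)"
        using indep_augment[OF less.prems(1) K(1)] lt K(3) by auto
      have "card (insert x I) = Suc (card I)"
        using x(1) finite_indep[OF less.prems(1)] by simp
      then have "\<exists>J. indep J \<and> insert x I \<subseteq> J \<and> J \<subseteq> X \<and> card J = rank X"
        using x K(2) less.prems(2) lt by (intro less.hyps) auto
      then show ?thesis by blast
    qed
  qed
  then show thesis using that by blast
qed

lemma rank_le_iff: "rank X \<le> n \<longleftrightarrow> (\<forall>I. indep I \<and> I \<subseteq> X \<longrightarrow> card I \<le> n)"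
proof
  assume "rank X \<le> n"
  then show "\<forall>I. indep I \<and> I \<subseteq> X \<longrightarrow> card I \<le> n"
    using card_le_rank order_trans by blast
next
  assume *: "\<forall>I. indep I \<and> I \<subseteq> X \<longrightarrow> card I \<le> n"
  obtain I where "indep I" "I \<subseteq> X" "card I = rank X" by (rule rank_attained)
  then show "rank X \<le> n" using * by auto
qed

lemma rank_mono: "X \<subseteq> Y \<Longrightarrow> rank X \<le> rank Y"
  unfolding rank_le_iff using card_le_rank by blast

lemma rank_insert_ge: "rank X \<le> rank (insert x X)"
  by (rule rank_mono) blast

lemma rank_indep: "indep I \<Longrightarrow> rank I = card I"
  by (rule antisym) (auto simp: rank_le_iff intro: card_mono finite_indep card_le_rank)

lemma rank_le_card: "finite X \<Longrightarrow> rank X \<le> card X"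
  by (simp add: card_mono rank_le_iff)

lemma indep_iff_rank: "X \<subseteq> E \<Longrightarrow> indep X \<longleftrightarrow> rank X = card X"
proof
  assume "X \<subseteq> E" "rank X = card X"
  moreover obtain I where "indep I" "I \<subseteq> X" "card I = rank X" by (rule rank_attained)
  ultimately show "indep X"
    using card_subset_eq[of X I] finite_subset[OF _ finite_ground] by auto
qed (rule rank_indep)

text \<open>A largest independent subset of \<open>X \<inter> Y\<close> is extended to one of
  \<open>X \<union> Y\<close>; the traces of the extension on \<open>X\<close> and \<open>Y\<close>
  cover it and overlap at least in the original set.\<close>

lemma rank_submodular: "rank (X \<union> Y) + rank (X \<inter> Y) \<le> rank X + rank Y"
proof -
  obtain I where I: "indep I" "I \<subseteq> X \<inter> Y" "card I = rank (X \<inter> Y)" by (rule rank_attained)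
  then obtain K where K: "indep K" "I \<subseteq> K" "K \<subseteq> X \<union> Y" "card K = rank (X \<union> Y)"
    using indep_extend[of I "X \<union> Y"] by auto
  have fin: "finite K" using K(1) by (rule finite_indep)
  have "card (K \<inter> X) \<le> rank X" "card (K \<inter> Y) \<le> rank Y"
    using indep_mono[OF K(1)] by (auto intro: card_le_rank)
  moreover have "card I \<le> card (K \<inter> X \<inter> (K \<inter> Y))"
    using I(2) K(2) fin by (intro card_mono) auto
  moreover have "card (K \<inter> X) + card (K \<inter> Y) = card (K \<inter> X \<union> K \<inter> Y) + card (K \<inter> X \<inter> (K \<inter> Y))"
    using fin by (intro card_Un_Int) auto
  moreover have "K \<inter> X \<union> K \<inter> Y = K" using K(3) by auto
  ultimately show ?thesis using I(3) K(4) by simp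
qed

section \<open>Span and flats\<close>

text \<open>The closure operator. The restriction to \<open>E\<close> matters: adding an element
  outside \<open>E\<close> never changes the rank.\<close>

definition span :: "'a set \<Rightarrow> 'a set" where
  "span X = {x \<in> E. rank (insert x X) = rank X}"

lemma span_subset_ground: "span X \<subseteq> E"
  by (auto simp: span_def)

lemma subset_span: "X \<subseteq> E \<Longrightarrow> X \<subseteq> span X"
  by (auto simp: span_def insert_absorb)

text \<open>By submodularity for \<open>insert x X\<close> and \<open>Y\<close>, an element that
  adds no rank to \<open>X\<close> adds none to a larger set.\<close>

lemma span_mono:
  assumes "X \<subseteq> Y"
  shows "span X \<subseteq> span Y"
proof
  fix x assume x: "x \<in> span X"
  have "rank (insert x Y) = rank Y"
  proof (cases "x \<in> Y")
    case False
    then have "insert x X \<union> Y = insert x Y" "insert x X \<inter> Y = X"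
      using assms by auto
    then have "rank (insert x Y) \<le> rank Y"
      using rank_submodular[of "insert x X" Y] x by (simp add: span_def)
    then show ?thesis using rank_insert_ge[of Y x] by simp
  qed (simp add: insert_absorb)
  then show "x \<in> span Y" using x by (simp add: span_def)
qed

lemma rank_Un_span:
  assumes "S \<subseteq> span X"
  shows "rank (X \<union> S) = rank X"
proof -
  have "finite S" using assms span_subset_ground finite_ground finite_subset by (metis subset_trans)
  then show ?thesis using assms
  proof (induction S)
    case (insert x S)
    then have "x \<in> span (X \<union> S)" using span_mono[of X "X \<union> S"] by auto
    then show ?case using insert by (simp add: span_def)
  qed simp
qed

lemma rank_span: "X \<subseteq> E \<Longrightarrow> rank (span X) = rank X"
  using rank_Un_span[of "span X" X] subset_span[of X] by (simp add: Un_absorb1)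

lemma span_span:
  assumes "X \<subseteq> E"
  shows "span (span X) = span X"
proof
  show "span (span X) \<subseteq> span X"
  proof
    fix x assume x: "x \<in> span (span X)"
    then have "rank (insert x (span X)) = rank X"
      using rank_span[OF assms] by (simp add: span_def)
    then have "rank (insert x X) \<le> rank X"
      using rank_mono[of "insert x X" "insert x (span X)"] subset_span[OF assms] by auto
    then show "x \<in> span X"
      using x rank_insert_ge[of X x] by (simp add: span_def)
  qed
  show "span X \<subseteq> span (span X)" by (simp add: span_subset_ground subset_span)
qed

lemma span_minimal: "X \<subseteq> span Y \<Longrightarrow> Y \<subseteq> E \<Longrightarrow> span X \<subseteq> span Y"
  using span_mono span_span by blast

text \<open>Turns rank comparisons into span inclusions: all sets between \<open>X\<close> and
  \<open>Y\<close> are squeezed to the same rank.\<close>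

lemma subset_span_if_rank_le:
  assumes "X \<subseteq> Y" and "Y \<subseteq> E" and "rank Y \<le> rank X"
  shows "Y \<subseteq> span X"
proof
  fix y assume "y \<in> Y"
  then have "rank (insert y X) \<le> rank Y" "rank X \<le> rank (insert y X)"
    using assms(1) by (auto intro!: rank_mono)
  then show "y \<in> span X" using assms \<open>y \<in> Y\<close> by (auto simp: span_def)
qed

lemma flat_iff_span: "flat F \<longleftrightarrow> F \<subseteq> E \<and> span F \<subseteq> F"
proof -
  have "rank F < rank (insert x F) \<longleftrightarrow> rank (insert x F) \<noteq> rank F" for x
    using rank_insert_ge[of F x] by auto
  then show ?thesis by (auto simp: flat_def span_def)
qed

lemma span_flat: "flat F \<Longrightarrow> span F = F"
  by (simp add: flat_iff_span subset_antisym subset_span)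

lemma in_span_iff_dependent:
  assumes "indep I" and "x \<in> E" and "x \<notin> I"
  shows "x \<in> span I \<longleftrightarrow> \<not> indep (insert x I)"
proof -
  have card: "card (insert x I) = Suc (card I)" using assms finite_indep by simp
  have "insert x I \<subseteq> E" using assms indep_subset_ground by blast
  then have "indep (insert x I) \<longleftrightarrow> rank (insert x I) = Suc (card I)"
    using card by (simp only: indep_iff_rank)
  moreover have "x \<in> span I \<longleftrightarrow> rank (insert x I) = card I"
    using assms by (simp add: span_def rank_indep)
  moreover have "rank (insert x I) \<le> Suc (card I)"
    using rank_le_card[of "insert x I"] assms finite_indep by simp
  moreover have "card I \<le> rank (insert x I)" using assms(1) by (auto intro: card_le_rank)
  ultimately show ?thesis by linarith
qed

lemma notin_span_Diff: "indep I \<Longrightarrow> x \<in> I \<Longrightarrow> x \<notin> span (I - {x})"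
  using in_span_iff_dependent[of "I - {x}" x] indep_mono[of I "I - {x}"] indep_subset_ground
  by (auto simp: insert_absorb)

section \<open>Circuits and cyclic flats\<close>

lemma contains_circuit:
  assumes "X \<subseteq> E" and "\<not> indep X"
  obtains C where "circuit C" "C \<subseteq> X"
proof -
  have "finite X" using assms(1) finite_ground finite_subset by blast
  then have "\<exists>C. circuit C \<and> C \<subseteq> X" using assms
  proof (induction X rule: finite_psubset_induct)
    case (psubset X)
    show ?case
    proof (cases "circuit X")
      case False
      then obtain D where "D \<subset> X" "\<not> indep D"
        using psubset.prems unfolding circuit_def by blast
      then show ?thesis using psubset.IH[of D] psubset.prems by blast
    qed blast
  qed
  then show thesis using that by blast
qed

lemma circuit_in_span:
  assumes "circuit C" and "x \<in> C"
  shows "x \<in> span (C - {x})"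
proof -
  have "indep (C - {x})" "x \<in> E" "insert x (C - {x}) = C"
    using assms unfolding circuit_def by auto
  then show ?thesis using assms in_span_iff_dependent[of "C - {x}" x] by (simp add: circuit_def)
qed

lemma rank_circuit:
  assumes "circuit C"
  shows "card C = Suc (rank C)"
proof -
  have fin: "finite C" using assms finite_ground finite_subset unfolding circuit_def by blast
  have "C \<noteq> {}" using assms indep_empty unfolding circuit_def by auto
  then obtain x where x: "x \<in> C" by blast
  then have "indep (C - {x})" using assms unfolding circuit_def by auto
  then have "card C - 1 \<le> rank C" using card_le_rank[of "C - {x}" C] x fin by simp
  moreover have "rank C \<noteq> card C" "rank C \<le> card C"
    using assms rank_le_card[OF fin] by (auto simp: circuit_def indep_iff_rank)
  ultimately show ?thesis by linarith
qed

lemma cyclic_subset_ground: "cyclic X \<Longrightarrow> X \<subseteq> E"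
  by (auto simp: cyclic_def circuit_def)

lemma circuit_cyclic: "circuit C \<Longrightarrow> cyclic C"
  unfolding cyclic_def by (rule exI[of _ "{C}"]) simp

lemma cyclic_iff: "cyclic X \<longleftrightarrow> (\<forall>x\<in>X. \<exists>C. circuit C \<and> x \<in> C \<and> C \<subseteq> X)"
proof
  assume "cyclic X"
  then show "\<forall>x\<in>X. \<exists>C. circuit C \<and> x \<in> C \<and> C \<subseteq> X" unfolding cyclic_def by blast
next
  assume "\<forall>x\<in>X. \<exists>C. circuit C \<and> x \<in> C \<and> C \<subseteq> X"
  then have "X = \<Union>{C. circuit C \<and> C \<subseteq> X}" by blast
  then show "cyclic X"
    unfolding cyclic_def by (intro exI[of _ "{C. circuit C \<and> C \<subseteq> X}"] conjI) auto
qed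

lemma cyclic_Union: "(\<And>X. X \<in> \<X> \<Longrightarrow> cyclic X) \<Longrightarrow> cyclic (\<Union>\<X>)"
  unfolding cyclic_iff by blast

text \<open>A point of the span outside \<open>X\<close> is spanned by a largest independent subset
  \<open>I\<close> of \<open>X\<close>, hence lies on a circuit whose other elements come from
  \<open>I\<close>.\<close>

lemma span_cyclic:
  assumes "cyclic X"
  shows "span X \<in> cyclic_flats"
proof -
  have XE: "X \<subseteq> E" using assms by (rule cyclic_subset_ground)
  have "\<exists>C. circuit C \<and> x \<in> C \<and> C \<subseteq> span X" if x: "x \<in> span X" for x
  proof (cases "x \<in> X")
    case True
    then show ?thesis using assms subset_span[OF XE] unfolding cyclic_iff by blast
  next
    case False
    obtain I where I: "indep I" "I \<subseteq> X" "card I = rank X" by (rule rank_attained)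
    then have "X \<subseteq> span I" by (intro subset_span_if_rank_le) (auto simp: rank_indep XE)
    then have "x \<in> span I" using x span_minimal[of X I] I(1) indep_subset_ground by blast
    then have "\<not> indep (insert x I)"
      using in_span_iff_dependent[of I x] I False span_subset_ground by blast
    then obtain C where C: "circuit C" "C \<subseteq> insert x I"
      using contains_circuit[of "insert x I"] I(1) indep_subset_ground x span_subset_ground
      by (metis insert_subset subsetD)
    have "x \<in> C" using C I(1) indep_mono[of I C] by (auto simp: circuit_def)
    then show ?thesis using C I(2) x subset_span[OF XE] by blast
  qed
  then have "cyclic (span X)" unfolding cyclic_iff by blast
  then show ?thesis
    by (simp add: cyclic_flats_def flat_iff_span span_span[OF XE] span_subset_ground)
qed

lemma cyclic_flats_subset_ground: "F \<in> cyclic_flats \<Longrightarrow> F \<subseteq> E"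
  by (simp add: cyclic_flats_def flat_def)

lemma span_cyclic_flat: "F \<in> cyclic_flats \<Longrightarrow> span F = F"
  by (simp add: cyclic_flats_def span_flat)

lemma finite_cyclic_flats: "finite cyclic_flats"
  by (rule finite_subset[of _ "Pow E"]) (use cyclic_flats_subset_ground finite_ground in auto)

section \<open>Spans inside an independent set, and fundamental bases\<close>

text \<open>Submodularity is applied to \<open>insert x S\<close> and \<open>insert x T\<close>.
  Their union has rank at least \<open>card (S \<union> T)\<close> by independence, which leaves at
  most \<open>card (S \<inter> T)\<close> for \<open>insert x (S \<inter> T)\<close>.\<close>

lemma span_Int:
  assumes "indep (S \<union> T)"
  shows "span S \<inter> span T \<subseteq> span (S \<inter> T)"
proof
  fix x assume x: "x \<in> span S \<inter> span T"
  have ind: "indep S" "indep T" "indep (S \<inter> T)"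
    by (auto intro: indep_mono[OF assms])
  have "rank (insert x S \<union> insert x T) + rank (insert x S \<inter> insert x T) \<le> card S + card T"
    using rank_submodular[of "insert x S" "insert x T"] x ind by (simp add: span_def rank_indep)
  moreover have "insert x S \<inter> insert x T = insert x (S \<inter> T)" by auto
  moreover have "card (S \<union> T) \<le> rank (insert x S \<union> insert x T)"
    using assms by (intro card_le_rank) auto
  moreover have "card S + card T = card (S \<union> T) + card (S \<inter> T)"
    using ind finite_indep by (intro card_Un_Int) auto
  ultimately have "rank (insert x (S \<inter> T)) \<le> rank (S \<inter> T)"
    using ind by (simp add: rank_indep)
  then show "x \<in> span (S \<inter> T)"
    using x rank_insert_ge[of "S \<inter> T" x] by (simp add: span_def)
qed

text \<open>Iterates the binary case. The assumption \<open>x \<in> span B\<close> covers the empty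
  family, whose intersection is the whole type.\<close>

lemma span_INT:
  assumes "indep B" and "finite \<S>" and "x \<in> span B" and "\<And>S. S \<in> \<S> \<Longrightarrow> x \<in> span (B \<inter> S)"
  shows "x \<in> span (B \<inter> \<Inter>\<S>)"
  using assms(2,4)
proof (induction \<S>)
  case (insert S \<S>)
  have "indep ((B \<inter> S) \<union> (B \<inter> \<Inter>\<S>))" using assms(1) by (rule indep_mono) auto
  then have "x \<in> span ((B \<inter> S) \<inter> (B \<inter> \<Inter>\<S>))"
    using insert span_Int[of "B \<inter> S" "B \<inter> \<Inter>\<S>"] by auto
  moreover have "(B \<inter> S) \<inter> (B \<inter> \<Inter>\<S>) = B \<inter> \<Inter>(insert S \<S>)" by auto
  ultimately show ?case by simp
qed (use assms(3) in simp)

text \<open>One inclusion suffices to say that \<open>F\<close> is spanned by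
  \<open>B \<inter> F\<close>, as a flat contains the span of each of its subsets.\<close>

definition fundamental_basis :: "'a set \<Rightarrow> bool" where
  "fundamental_basis B \<longleftrightarrow> indep B \<and> card B = rank E \<and> (\<forall>F\<in>cyclic_flats. F \<subseteq> span (B \<inter> F))"

lemma basis_span: "indep B \<Longrightarrow> card B = rank E \<Longrightarrow> span B = E"
  using subset_span_if_rank_le[of B E] indep_subset_ground span_subset_ground
  by (simp add: rank_indep subset_antisym)

text \<open>Not restricted to cyclic flats, because it is also applied to the intersection of a
  filter.\<close>

lemma rank_fundamental_basis:
  assumes "fundamental_basis B" and "F \<subseteq> E" and "F \<subseteq> span (B \<inter> F)"
  shows "rank F = card (B \<inter> F)"
proof -
  have "indep (B \<inter> F)"
    using assms(1) unfolding fundamental_basis_def by (auto intro: indep_mono[of B])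
  then have "rank (B \<inter> F) = card (B \<inter> F)" by (rule rank_indep)
  moreover have "rank (span (B \<inter> F)) = rank (B \<inter> F)" using assms(2) by (intro rank_span) auto
  ultimately show ?thesis
    using rank_mono[OF assms(3)] rank_mono[of "B \<inter> F" F] by simp
qed

section \<open>Fundamental presentations versus fundamental bases\<close>

text \<open>One private element per member forms the basis. A circuit is a minimal failure of Hall's
  condition, so its span contains the private elements of all members that it meets, and these in
  turn span the circuit.\<close>

lemma fundamental_transversal_imp_basis:
  assumes fundamental_transversal
  shows "\<exists>B. fundamental_basis B"
proof -
  obtain As where As: "presentation As"
    and "\<forall>i < length As. As ! i - (\<Union>j \<in> {..<length As} - {i}. As ! j) \<noteq> {}"
    using assms unfolding fundamental_transversal_def by blast
  then have "\<forall>i. \<exists>x. i < length As \<longrightarrow> x \<in> As ! i - (\<Union>j \<in> {..<length As} - {i}. As ! j)"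
    by blast
  from choice[OF this] obtain b
    where b: "\<And>i. i < length As \<Longrightarrow> b i \<in> As ! i - (\<Union>j \<in> {..<length As} - {i}. As ! j)"
    by blast
  have b_mem: "b i \<in> As ! j \<longleftrightarrow> i = j" if "i < length As" "j < length As" for i j
    using b[OF that(1)] that by auto
  have indep_iff: "indep I \<longleftrightarrow> partial_transversal E As I" for I
    using As by (simp add: presentation_def)
  have As_ground: "As ! i \<subseteq> E" if "i < length As" for i
    using As that by (simp add: presentation_def set_system_def)
  \<comment> \<open>The number of members meeting a set bounds its rank. Sets of private elements
    attain the bound, because \<open>b i\<close> lies in member \<open>i\<close> only.\<close>
  define N where "N X = {i. i < length As \<and> As ! i \<inter> X \<noteq> {}}" for X
  have finN: "finite (N X)" and N_less: "N X \<subseteq> {..<length As}" for X by (auto simp: N_def)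
  have indep_card: "card I \<le> card (N I)" if "indep I" for I
    using that partial_transversal_card_le[of E As I] by (simp add: indep_iff N_def)
  have N_mono: "N X \<subseteq> N Y" if "X \<subseteq> Y" for X Y
    using that by (auto simp: N_def)
  have N_b: "N (b ` K) = K" if "K \<subseteq> {..<length As}" for K
  proof -
    have "As ! i \<inter> b ` K \<noteq> {} \<longleftrightarrow> i \<in> K" if "i < length As" for i
      using b_mem[OF _ that] \<open>K \<subseteq> {..<length As}\<close> by (auto simp: disjoint_iff subset_iff)
    then show ?thesis using that by (auto simp: N_def)
  qed
  have inj_b: "inj_on b {..<length As}"
    by (rule inj_onI) (metis b_mem lessThan_iff)
  have indep_b: "indep (b ` K)" if K: "K \<subseteq> {..<length As}" for K
    unfolding indep_iff
  proof (rule partial_transversalI_hall)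
    have "b i \<in> E" if "i < length As" for i
      using b_mem[OF that that] As_ground[OF that] by auto
    then show "b ` K \<subseteq> E" using K by auto
    show "finite (b ` K)" using finite_subset[OF K] by simp
    fix J assume "J \<subseteq> b ` K"
    then obtain L where L: "L \<subseteq> K" "J = b ` L" by (auto simp: subset_image_iff)
    have LK: "L \<subseteq> {..<length As}" using L(1) K by (rule subset_trans)
    then have "finite L" by (rule finite_subset) simp
    then have "card J \<le> card L" unfolding L(2) by (rule card_image_le)
    then show "card J \<le> card {i. i < length As \<and> As ! i \<inter> J \<noteq> {}}"
      using N_b[OF LK] by (simp add: L(2) N_def)
  qed
  have rank_le: "rank X \<le> card (N X)" for X
    unfolding rank_le_iff using indep_card card_mono[OF finN N_mono] order_trans by blast
  have card_b: "card (b ` K) = card K" if "K \<subseteq> {..<length As}" for K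
    using that inj_b by (intro card_image) (rule inj_on_subset)
  define B where "B = b ` {..<length As}"
  have B: "indep B" "card B = length As"
    using indep_b[of "{..<length As}"] card_b[of "{..<length As}"] by (auto simp: B_def)
  have "rank E \<le> length As"
    using rank_le[of E] card_mono[OF _ N_less[of E]] by simp
  moreover have "card B \<le> rank E"
    using B(1) by (rule card_le_rank) (rule indep_subset_ground[OF B(1)])
  ultimately have card_B: "card B = rank E" using B(2) by simp
  have "C \<subseteq> span (B \<inter> F)" if F: "F \<in> cyclic_flats" and C: "circuit C" "C \<subseteq> F" for F C
  proof -
    have CE: "C \<subseteq> E" using C(1) by (simp add: circuit_def)
    have finC: "finite C" using CE finite_ground finite_subset by blast
    \<comment> \<open>Proper subsets of a circuit are independent and satisfy Hall's inequality, so
      the dependent set \<open>C\<close> itself must violate it.\<close>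
    have "card (N C) < card C"
    proof (rule ccontr)
      assume *: "\<not> card (N C) < card C"
      have "partial_transversal E As C"
      proof (rule partial_transversalI_hall[OF CE finC])
        fix J assume "J \<subseteq> C"
        then consider "J = C" | "indep J" using C(1) by (auto simp: circuit_def)
        then have "card J \<le> card (N J)" using * indep_card by cases auto
        then show "card J \<le> card {i. i < length As \<and> As ! i \<inter> J \<noteq> {}}" by (simp add: N_def)
      qed
      then show False using C(1) by (simp add: circuit_def indep_iff)
    qed
    then have rank_C: "card (N C) \<le> rank C" using rank_circuit[OF C(1)] by simp
    \<comment> \<open>\<open>P\<close>, \<open>C\<close> and \<open>C \<union> P\<close> meet the
      same members and all have rank \<open>card (N C)\<close>; thus \<open>P\<close> and
      \<open>C\<close> span each other.\<close>
    define P where "P = b ` N C"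
    have P: "indep P" "card P = card (N C)" "P \<subseteq> B"
      unfolding P_def B_def by (intro indep_b card_b image_mono N_less)+
    then have rank_P: "rank P = card (N C)" by (simp add: rank_indep)
    have "N (C \<union> P) = N C \<union> N P" by (auto simp: N_def)
    then have "N (C \<union> P) = N C" using N_b[OF N_less] by (simp add: P_def)
    then have rank_CP: "rank (C \<union> P) \<le> card (N C)" using rank_le[of "C \<union> P"] by simp
    have CPE: "C \<union> P \<subseteq> E" using CE indep_subset_ground[OF P(1)] by blast
    have "P \<subseteq> span C"
      using subset_span_if_rank_le[of C "C \<union> P"] CPE rank_C rank_CP by auto
    then have "P \<subseteq> F" using span_mono[OF C(2)] span_cyclic_flat[OF F] by simp
    moreover have "C \<subseteq> span P"
      using subset_span_if_rank_le[of P "C \<union> P"] CPE rank_P rank_CP by auto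
    ultimately show ?thesis using span_mono[of P "B \<inter> F"] P(3) by blast
  qed
  then have "F \<subseteq> span (B \<inter> F)" if "F \<in> cyclic_flats" for F
    using that unfolding cyclic_flats_def cyclic_iff by blast
  then show ?thesis using B(1) card_B unfolding fundamental_basis_def by blast
qed

text \<open>The members \<open>A b\<close> are the fundamental cocircuits of \<open>B\<close>.
  Independence yields Hall's inequalities by rank counting; a circuit violates them because its span
  is a cyclic flat, spanned by its part of \<open>B\<close>.\<close>

lemma fundamental_transversalI_basis:
  assumes "fundamental_basis B"
  shows fundamental_transversal
proof -
  have B: "indep B" and card_B: "card B = rank E"
    and spanned: "\<And>F. F \<in> cyclic_flats \<Longrightarrow> F \<subseteq> span (B \<inter> F)"
    using assms by (auto simp: fundamental_basis_def)
  have span_B: "span B = E" using B card_B by (rule basis_span)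
  have BE: "B \<subseteq> E" using B by (rule indep_subset_ground)
  obtain bs where bs: "set bs = B" "distinct bs"
    using finite_distinct_list[OF finite_indep[OF B]] by blast
  define A where "A b = E - span (B - {b})" for b
  define As where "As = map A bs"
  define N where "N J = {b \<in> B. A b \<inter> J \<noteq> {}}" for J
  have finN: "finite (N J)" for J using finite_indep[OF B] by (simp add: N_def)
  have card_N: "card {i. i < length As \<and> As ! i \<inter> J \<noteq> {}} = card (N J)" for J
  proof -
    have "{i. i < length As \<and> As ! i \<inter> J \<noteq> {}} = {i. i < length bs \<and> A (bs ! i) \<inter> J \<noteq> {}}"
      by (auto simp: As_def)
    then have "card {i. i < length As \<and> As ! i \<inter> J \<noteq> {}} = length (filter (\<lambda>b. A b \<inter> J \<noteq> {}) bs)"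
      by (simp add: length_filter_conv_card)
    also have "\<dots> = card (set (filter (\<lambda>b. A b \<inter> J \<noteq> {}) bs))"
      using bs(2) by (intro distinct_card[symmetric]) simp
    also have "set (filter (\<lambda>b. A b \<inter> J \<noteq> {}) bs) = N J" using bs(1) by (auto simp: N_def)
    finally show ?thesis .
  qed
  \<comment> \<open>A point of \<open>J\<close> avoids \<open>A b\<close> for each
    \<open>b \<in> B\<close> outside \<open>N J\<close>, so it is spanned by every such
    \<open>B - {b}\<close>; intersecting these spans leaves \<open>span (N J)\<close>.\<close>
  have "J \<subseteq> span (N J)" if J: "J \<subseteq> E" for J
  proof
    fix x assume x: "x \<in> J"
    have "x \<in> span (B \<inter> \<Inter>((\<lambda>b. - {b}) ` (B - N J)))"
    proof (rule span_INT)
      fix S assume "S \<in> (\<lambda>b. - {b}) ` (B - N J)"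
      then obtain b where b: "b \<in> B" "b \<notin> N J" "S = - {b}" by blast
      then have "x \<in> span (B - {b})" using x J by (auto simp: N_def A_def)
      then show "x \<in> span (B \<inter> S)" by (simp add: b(3) Diff_eq)
    qed (use B x J span_B finite_indep[OF B] in auto)
    moreover have "B \<inter> \<Inter>((\<lambda>b. - {b}) ` (B - N J)) = N J" by (auto simp: N_def)
    ultimately show "x \<in> span (N J)" by simp
  qed
  then have rank_le: "rank J \<le> card (N J)" if "J \<subseteq> E" for J
    using that rank_mono[of J "span (N J)"] rank_span[of "N J"] rank_le_card[OF finN, of J] BE
    by (force simp: N_def)
  have "partial_transversal E As I" if I: "indep I" for I
  proof (rule partial_transversalI_hall)
    fix J assume "J \<subseteq> I"
    then have "indep J" using I indep_mono by blast
    then show "card J \<le> card {i. i < length As \<and> As ! i \<inter> J \<noteq> {}}"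
      using rank_le[of J] indep_subset_ground[of J] rank_indep[of J] by (simp add: card_N)
  qed (use I indep_subset_ground finite_indep in auto)
  moreover have "indep I" if I: "partial_transversal E As I" for I
  proof (rule ccontr)
    assume "\<not> indep I"
    moreover have "I \<subseteq> E" using I by (simp add: partial_transversal_def)
    ultimately obtain C where C: "circuit C" "C \<subseteq> I" using contains_circuit by blast
    have CE: "C \<subseteq> E" using C(1) by (simp add: circuit_def)
    have F: "span C \<in> cyclic_flats" using span_cyclic[OF circuit_cyclic[OF C(1)]] .
    have C_span: "C \<subseteq> span (B \<inter> span C)" using spanned[OF F] subset_span[OF CE] by blast
    \<comment> \<open>If \<open>b\<close> were outside \<open>span C\<close>, then \<open>C\<close>
      would be spanned by \<open>B - {b}\<close> and miss \<open>A b\<close>.\<close>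
    have "N C \<subseteq> B \<inter> span C"
    proof
      fix b assume b: "b \<in> N C"
      have "b \<in> span C"
      proof (rule ccontr)
        assume "b \<notin> span C"
        then have "span (B \<inter> span C) \<subseteq> span (B - {b})" by (intro span_mono) blast
        then show False using b C_span by (auto simp: N_def A_def)
      qed
      then show "b \<in> B \<inter> span C" using b by (simp add: N_def)
    qed
    then have "card (N C) \<le> card (B \<inter> span C)"
      using finite_indep[OF B] by (intro card_mono) auto
    also have "\<dots> = rank (span C)"
      using rank_fundamental_basis[OF assms cyclic_flats_subset_ground[OF F] spanned[OF F]] by simp
    also have "\<dots> = rank C" using CE by (rule rank_span)
    finally have "card (N C) < card C" using rank_circuit[OF C(1)] by simp
    then show False
      using partial_transversal_card_le[OF partial_transversal_mono[OF I C(2)]] card_N by simp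
  qed
  ultimately have "presentation As"
    by (auto simp: presentation_def set_system_def As_def A_def)
  \<comment> \<open>The element \<open>bs ! i\<close> is private to member \<open>i\<close>: it is
    not spanned by the rest of \<open>B\<close>, but it belongs to \<open>B - {bs ! j}\<close> for
    every other \<open>j\<close>.\<close>
  moreover have "As ! i - (\<Union>j \<in> {..<length As} - {i}. As ! j) \<noteq> {}" if i: "i < length As" for i
  proof -
    have len: "length As = length bs" by (simp add: As_def)
    have "bs ! i \<in> B" using i bs(1) len by auto
    then have "bs ! i \<in> As ! i" using notin_span_Diff[OF B] BE i by (auto simp: As_def A_def)
    moreover have "bs ! i \<notin> As ! j" if "j < length As" "j \<noteq> i" for j
    proof -
      have "bs ! i \<in> B - {bs ! j}"
        using \<open>bs ! i \<in> B\<close> bs(2) i that len by (simp add: nth_eq_iff_index_eq)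
      then have "bs ! i \<in> span (B - {bs ! j})" using subset_span[of "B - {bs ! j}"] BE by blast
      then show ?thesis using that(1) by (simp add: As_def A_def)
    qed
    ultimately show ?thesis by blast
  qed
  ultimately show ?thesis unfolding fundamental_transversal_def by blast
qed

section \<open>The function beta as a count over a fundamental basis\<close>

lemma sum_card_fibres:
  assumes "finite B" and "finite T"
  shows "(\<Sum>y\<in>T. card {b \<in> B. f b = y}) = card {b \<in> B. f b \<in> T}"
proof -
  have "{b \<in> B. f b \<in> T} = (\<Union>y\<in>T. {b \<in> B. f b = y})" by auto
  then have "card {b \<in> B. f b \<in> T} = card (\<Union>y\<in>T. {b \<in> B. f b = y})" by simp
  also have "\<dots> = (\<Sum>y\<in>T. card {b \<in> B. f b = y})"
    using assms by (intro card_UN_disjoint) auto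
  finally show ?thesis by simp
qed

text \<open>The recursion with \<open>beta F\<close> moved into the sum: the filter identity for the
  principal filter of \<open>F\<close> holds in every matroid.\<close>

lemma sum_beta_supersets:
  assumes "F \<in> cyclic_flats"
  shows "(\<Sum>Y\<in>{Y \<in> cyclic_flats. F \<subseteq> Y}. beta Y) = int (rank E) - int (rank F)"
proof -
  have "{Y \<in> cyclic_flats. F \<subseteq> Y} = insert F {Y \<in> cyclic_flats. F \<subset> Y}" using assms by auto
  then show ?thesis using finite_cyclic_flats beta.simps[of F] by simp
qed

text \<open>Each \<open>b\<close> outside \<open>\<Inter>\<F>\<close> is counted once on the left,
  at \<open>Y b\<close>; the elements of \<open>B\<close> inside account for the subtracted rank.
  Intersecting with \<open>E\<close> settles the empty filter.\<close>

lemma fundamental_basis_imp_sum_beta: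
  assumes "fundamental_basis B" and "cyclic_flats_filter \<F>"
  shows "(\<Sum>Y\<in>\<F>. beta Y) = int (rank E) - int (rank (E \<inter> \<Inter>\<F>))"
proof -
  have B: "indep B" and card_B: "card B = rank E"
    and spanned: "\<And>F. F \<in> cyclic_flats \<Longrightarrow> F \<subseteq> span (B \<inter> F)"
    using assms(1) by (auto simp: fundamental_basis_def)
  have finB: "finite B" using B by (rule finite_indep)
  have span_B: "span B = E" using B card_B by (rule basis_span)
  have BE: "B \<subseteq> E" using B by (rule indep_subset_ground)
  \<comment> \<open>For \<open>b \<in> B\<close>, all cyclic flats avoiding \<open>b\<close> lie in
    \<open>span (B - {b})\<close>, so the span of their union still avoids \<open>b\<close> and is
    the largest such cyclic flat.\<close>
  define Y where "Y b = span (\<Union>{F \<in> cyclic_flats. b \<notin> F})" for b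
  have Y_flat: "Y b \<in> cyclic_flats" for b
    unfolding Y_def by (intro span_cyclic cyclic_Union) (simp add: cyclic_flats_def)
  have Y_iff: "F \<subseteq> Y b \<longleftrightarrow> b \<notin> F" if "b \<in> B" "F \<in> cyclic_flats" for b F
  proof
    assume "F \<subseteq> Y b"
    have "G \<subseteq> span (B - {b})" if "G \<in> cyclic_flats" "b \<notin> G" for G
      using spanned[OF that(1)] span_mono[of "B \<inter> G" "B - {b}"] that(2) by blast
    then have "Y b \<subseteq> span (B - {b})"
      unfolding Y_def using BE by (intro span_minimal) blast+
    then show "b \<notin> F" using \<open>F \<subseteq> Y b\<close> notin_span_Diff[OF B \<open>b \<in> B\<close>] by blast
  next
    assume "b \<notin> F"
    then have "F \<subseteq> \<Union>{F \<in> cyclic_flats. b \<notin> F}" using that(2) by blast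
    then show "F \<subseteq> Y b"
      unfolding Y_def using subset_span[of "\<Union>{F \<in> cyclic_flats. b \<notin> F}"] cyclic_flats_subset_ground
      by blast
  qed
  have beta_eq: "beta F = int (card {b \<in> B. Y b = F})" if "F \<in> cyclic_flats" for F
    using that
  proof (induction F rule: beta.induct)
    case (1 F)
    have "(\<Sum>G \<in> {G \<in> cyclic_flats. F \<subset> G}. beta G)
        = (\<Sum>G \<in> {G \<in> cyclic_flats. F \<subset> G}. int (card {b \<in> B. Y b = G}))"
      using 1 by (intro sum.cong) auto
    also have "\<dots> = int (card {b \<in> B. Y b \<in> {G \<in> cyclic_flats. F \<subset> G}})"
      using finB finite_cyclic_flats by (subst sum_card_fibres[symmetric]) auto
    also have "{b \<in> B. Y b \<in> {G \<in> cyclic_flats. F \<subset> G}} = {b \<in> B. F \<subset> Y b}"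
      using Y_flat by auto
    finally have *: "(\<Sum>G \<in> {G \<in> cyclic_flats. F \<subset> G}. beta G) = int (card {b \<in> B. F \<subset> Y b})" .
    \<comment> \<open>The elements of \<open>B\<close> outside \<open>F\<close> are those with
      \<open>F \<subseteq> Y b\<close>; splitting off equality matches the recursion for
      \<open>beta F\<close> term by term.\<close>
    have "B = (B \<inter> F) \<union> ({b \<in> B. F \<subset> Y b} \<union> {b \<in> B. Y b = F})"
      using Y_iff[OF _ 1(2)] by auto
    moreover have "card \<dots> = card (B \<inter> F) + card ({b \<in> B. F \<subset> Y b} \<union> {b \<in> B. Y b = F})"
      using finB Y_iff[OF _ 1(2)] by (intro card_Un_disjoint) auto
    moreover have "card ({b \<in> B. F \<subset> Y b} \<union> {b \<in> B. Y b = F})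
        = card {b \<in> B. F \<subset> Y b} + card {b \<in> B. Y b = F}"
      using finB by (intro card_Un_disjoint) auto
    moreover have "rank F = card (B \<inter> F)"
      using rank_fundamental_basis[OF assms(1) cyclic_flats_subset_ground spanned] 1(2) by blast
    ultimately show ?case using * card_B beta.simps[of F] by simp
  qed
  have sub: "\<F> \<subseteq> cyclic_flats" using assms(2) by (simp add: cyclic_flats_filter_def)
  have finF: "finite \<F>" using sub finite_cyclic_flats finite_subset by blast
  have in_filter: "Y b \<in> \<F> \<longleftrightarrow> b \<notin> \<Inter>\<F>" if "b \<in> B" for b
  proof
    assume "Y b \<in> \<F>"
    then show "b \<notin> \<Inter>\<F>" using Y_iff[OF that Y_flat[of b]] by auto
  next
    assume "b \<notin> \<Inter>\<F>"
    then obtain F where "F \<in> \<F>" "b \<notin> F" by blast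
    then show "Y b \<in> \<F>"
      using Y_iff[OF that, of F] sub Y_flat[of b] assms(2) unfolding cyclic_flats_filter_def by blast
  qed
  have "(\<Sum>G\<in>\<F>. beta G) = (\<Sum>G\<in>\<F>. int (card {b \<in> B. Y b = G}))"
    using sub beta_eq by (intro sum.cong) auto
  also have "\<dots> = int (card {b \<in> B. Y b \<in> \<F>})"
    using finB finF by (subst sum_card_fibres[symmetric]) auto
  also have "{b \<in> B. Y b \<in> \<F>} = B - B \<inter> (E \<inter> \<Inter>\<F>)"
    using in_filter BE by auto
  also have "int (card \<dots>) = int (card B) - int (card (B \<inter> (E \<inter> \<Inter>\<F>)))"
    using finB by (simp add: card_Diff_subset card_mono of_nat_diff)
  \<comment> \<open>The intersection need not be cyclic, but it is still spanned by its part of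
    \<open>B\<close>, since spans of subsets of \<open>B\<close> intersect in the span of the
    intersection.\<close>
  also have "card (B \<inter> (E \<inter> \<Inter>\<F>)) = rank (E \<inter> \<Inter>\<F>)"
  proof (rule rank_fundamental_basis[OF assms(1), symmetric])
    show "E \<inter> \<Inter>\<F> \<subseteq> span (B \<inter> (E \<inter> \<Inter>\<F>))"
    proof
      fix x assume x: "x \<in> E \<inter> \<Inter>\<F>"
      have "x \<in> span (B \<inter> \<Inter>\<F>)"
      proof (rule span_INT[OF B finF])
        show "x \<in> span B" using x span_B by simp
        show "x \<in> span (B \<inter> F)" if "F \<in> \<F>" for F using x spanned[of F] sub that by blast
      qed
      moreover have "B \<inter> (E \<inter> \<Inter>\<F>) = B \<inter> \<Inter>\<F>" using BE by auto
      ultimately show "x \<in> span (B \<inter> (E \<inter> \<Inter>\<F>))" by simp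
    qed
  qed simp
  finally show ?thesis using card_B by simp
qed

section \<open>Construction of a fundamental basis from the filter identities\<close>

text \<open>Each cyclic flat \<open>F\<close> contributes \<open>beta F\<close> elements
  \<open>X F\<close>. Avoiding \<open>F\<close> while lying in every cyclic flat not below
  \<open>F\<close> makes these sets disjoint and decides which of them a given cyclic flat contains;
  independence over \<open>F\<close> makes their union independent.\<close>

lemma sum_beta_imp_fundamental_basis:
  assumes eq: "\<And>\<F>. cyclic_flats_filter \<F> \<Longrightarrow>
    (\<Sum>Y\<in>\<F>. beta Y) = int (rank E) - int (rank (E \<inter> \<Inter>\<F>))"
  shows "\<exists>B. fundamental_basis B"
proof -
  define J where "J F = E \<inter> \<Inter>{Y \<in> cyclic_flats. \<not> Y \<subseteq> F}" for F
  have "\<exists>X. X \<subseteq> J F - F \<and> int (card X) = beta F \<and> rank (F \<union> X) = rank F + card X"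
    if F: "F \<in> cyclic_flats" for F
  proof -
    have FE: "F \<subseteq> E" using F by (rule cyclic_flats_subset_ground)
    \<comment> \<open>The filter of cyclic flats properly above \<open>F\<close> has intersection
      \<open>K\<close>; its identity and the recursion give \<open>beta F\<close> as
      \<open>rank K - rank F\<close>, which is nonnegative.\<close>
    define K where "K = E \<inter> \<Inter>{Y \<in> cyclic_flats. F \<subset> Y}"
    have "(\<Sum>Y\<in>{Y \<in> cyclic_flats. F \<subset> Y}. beta Y) = int (rank E) - int (rank K)"
      unfolding K_def by (rule eq) (auto simp: cyclic_flats_filter_def)
    then have beta_K: "beta F = int (rank K) - int (rank F)" using beta.simps[of F] by simp
    \<comment> \<open>Both \<open>G\<close> and \<open>insert F G\<close> are filters; subtracting
      their identities gives \<open>beta F\<close> as the rank gained from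
      \<open>J F \<inter> F\<close> to \<open>J F\<close>.\<close>
    define G where "G = {Y \<in> cyclic_flats. \<not> Y \<subseteq> F}"
    have "finite G" using finite_cyclic_flats by (simp add: G_def)
    have "(\<Sum>Y\<in>G. beta Y) = int (rank E) - int (rank (J F))"
      unfolding J_def G_def by (rule eq) (auto simp: cyclic_flats_filter_def)
    moreover have "(\<Sum>Y\<in>insert F G. beta Y) = int (rank E) - int (rank (E \<inter> \<Inter>(insert F G)))"
      by (rule eq) (use F in \<open>auto simp: cyclic_flats_filter_def G_def\<close>)
    moreover have "E \<inter> \<Inter>(insert F G) = J F \<inter> F" by (auto simp: J_def G_def)
    moreover have "F \<notin> G" by (simp add: G_def)
    ultimately have beta_J: "beta F = int (rank (J F)) - int (rank (J F \<inter> F))"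
      using \<open>finite G\<close> by simp
    have FK: "F \<subseteq> K" using FE by (auto simp: K_def)
    then obtain n where n: "beta F = int n" "rank K = rank F + n"
      using beta_K rank_mono[OF FK] by (metis add_diff_cancel_left' le_Suc_ex of_nat_diff)
    define S where "S = J F - F"
    have SE: "S \<subseteq> E" by (auto simp: S_def J_def)
    then have finS: "finite S" using finite_ground finite_subset by blast
    obtain I where I: "indep I" "I \<subseteq> F" "card I = rank F" by (rule rank_attained)
    \<comment> \<open>A circuit inside \<open>F \<union> S\<close> but not inside \<open>F\<close> generates with \<open>F\<close> a larger cyclic flat,
      which contains \<open>K\<close>; without such a circuit \<open>S\<close> is independent over \<open>F\<close>.\<close>
    have rank_FS: "rank F + n \<le> rank (F \<union> S)"
    proof (cases "indep (I \<union> S)")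
      case True
      \<comment> \<open>By \<open>beta_J\<close> the rank grows by \<open>n\<close> from
        \<open>J F \<inter> F\<close> to \<open>J F\<close>, so \<open>S\<close> has at least
        \<open>n\<close> elements.\<close>
      have "J F = (J F \<inter> F) \<union> S" by (auto simp: S_def)
      then have "rank (J F) \<le> rank (J F \<inter> F) + rank S"
        using rank_submodular[of "J F \<inter> F" S] by simp
      then have "n \<le> card S" using beta_J n(1) rank_le_card[OF finS] by simp
      moreover have "card (I \<union> S) = rank F + card S"
        using I finS finite_indep[OF I(1)] by (subst card_Un_disjoint) (auto simp: S_def)
      moreover have "card (I \<union> S) \<le> rank (F \<union> S)" using True I(2) by (intro card_le_rank) auto
      ultimately show ?thesis by simp
    next
      case False
      have "I \<union> S \<subseteq> E" using I(2) FE SE by blast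
      then obtain C where C: "circuit C" "C \<subseteq> I \<union> S" using contains_circuit False by blast
      have "\<not> C \<subseteq> I" using C(1) I(1) indep_mono by (auto simp: circuit_def)
      then have "F \<subset> F \<union> C" using C(2) by (auto simp: S_def)
      moreover have FCE: "F \<union> C \<subseteq> E" using FE C(1) by (simp add: circuit_def)
      ultimately have "F \<subset> span (F \<union> C)" using subset_span[of "F \<union> C"] by blast
      moreover have "cyclic (\<Union>{F, C})"
        using F circuit_cyclic[OF C(1)] by (intro cyclic_Union) (auto simp: cyclic_flats_def)
      then have "span (F \<union> C) \<in> cyclic_flats" using span_cyclic by simp
      ultimately have "K \<subseteq> span (F \<union> C)" by (auto simp: K_def)
      then have "rank K \<le> rank (F \<union> C)" using rank_mono rank_span[OF FCE] by metis
      also have "\<dots> \<le> rank (F \<union> S)" using C(2) I(2) by (intro rank_mono) blast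
      finally show ?thesis using n(2) by simp
    qed
    \<comment> \<open>At most \<open>rank F\<close> elements of the extension \<open>I'\<close> lie
      in \<open>F\<close>, so at least \<open>n\<close> lie in \<open>S\<close>; any
      \<open>n\<close> of these serve as the set for \<open>F\<close>.\<close>
    have "I \<subseteq> F \<union> S" using I(2) by blast
    then obtain I' where I': "indep I'" "I \<subseteq> I'" "I' \<subseteq> F \<union> S" "card I' = rank (F \<union> S)"
      using indep_extend[OF I(1)] by blast
    have finI': "finite I'" using I'(1) by (rule finite_indep)
    have "indep (I' \<inter> F)" using I'(1) by (rule indep_mono) blast
    then have "card (I' \<inter> F) \<le> rank F" by (rule card_le_rank) blast
    moreover have "card I' = card (I' \<inter> F) + card (I' - F)"
      using finI' by (simp add: card_Diff_subset_Int card_mono)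
    ultimately have "n \<le> card (I' - F)" using rank_FS I'(4) by simp
    then obtain X where X: "X \<subseteq> I' - F" "card X = n" "finite X"
      by (rule obtain_subset_with_card_n)
    have "card (I \<union> X) = rank F + card X"
      using I X finite_indep[OF I(1)] by (subst card_Un_disjoint) auto
    moreover have "indep (I \<union> X)" using I'(1) by (rule indep_mono) (use I'(2) X(1) in auto)
    then have "card (I \<union> X) \<le> rank (F \<union> X)" by (rule card_le_rank) (use I(2) in auto)
    moreover have "rank (F \<union> X) \<le> rank F + card X"
      using rank_submodular[of F X] rank_le_card[OF X(3)] by simp
    ultimately have "rank (F \<union> X) = rank F + card X" by simp
    moreover have "X \<subseteq> J F - F" using X(1) I'(3) by (auto simp: S_def)
    ultimately show ?thesis using X(2) n(1) by auto
  qed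
  then have "\<forall>F\<in>cyclic_flats. \<exists>X. X \<subseteq> J F - F \<and> int (card X) = beta F \<and> rank (F \<union> X) = rank F + card X"
    by blast
  from bchoice[OF this] obtain X where X: "\<And>F. F \<in> cyclic_flats \<Longrightarrow> X F \<subseteq> J F - F"
    and card_X: "\<And>F. F \<in> cyclic_flats \<Longrightarrow> int (card (X F)) = beta F"
    and rank_X: "\<And>F. F \<in> cyclic_flats \<Longrightarrow> rank (F \<union> X F) = rank F + card (X F)"
    by blast
  have X_sub: "X F \<subseteq> Y" if "F \<in> cyclic_flats" "Y \<in> cyclic_flats" "\<not> Y \<subseteq> F" for F Y
    using X[OF that(1)] that(2,3) by (auto simp: J_def)
  have X_disj: "X F \<inter> F = {}" if "F \<in> cyclic_flats" for F
    using X[OF that] by blast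
  have XE: "X F \<subseteq> E" if "F \<in> cyclic_flats" for F
    using X[OF that] by (auto simp: J_def)
  have finX: "finite (X F)" if "F \<in> cyclic_flats" for F
    using XE[OF that] finite_ground finite_subset by blast
  \<comment> \<open>Either \<open>Y\<close> is properly inside \<open>F\<close>, and
    \<open>X Y\<close> lies in \<open>F\<close>, which \<open>X F\<close> avoids; or
    \<open>Y \<subseteq> F\<close> fails, and \<open>X F\<close> lies in \<open>Y\<close>, which
    \<open>X Y\<close> avoids.\<close>
  have disj: "X F \<inter> X Y = {}" if "F \<in> cyclic_flats" "Y \<in> cyclic_flats" "F \<noteq> Y" for F Y
  proof (cases "Y \<subseteq> F")
    case True
    then have "X Y \<subseteq> F" using X_sub[of Y F] that by auto
    then show ?thesis using X_disj[OF that(1)] by blast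
  next
    case False
    then show ?thesis using X_sub[OF that(1,2)] X_disj[OF that(2)] by blast
  qed
  have card_UN: "int (card (\<Union>F\<in>T. X F)) = (\<Sum>F\<in>T. beta F)" if T: "T \<subseteq> cyclic_flats" for T
  proof -
    have "finite T" using T finite_cyclic_flats finite_subset by blast
    then have "card (\<Union>F\<in>T. X F) = (\<Sum>F\<in>T. card (X F))"
      using T finX disj by (intro card_UN_disjoint) blast+
    then show ?thesis using T card_X by (simp add: subset_iff)
  qed
  define B where "B = (\<Union>F\<in>cyclic_flats. X F)"
  have BE: "B \<subseteq> E" using XE by (auto simp: B_def)
  have indep_B: "indep B"
  proof (rule ccontr)
    assume "\<not> indep B"
    then obtain C where C: "circuit C" "C \<subseteq> B" using contains_circuit BE by blast
    define T where "T = {F \<in> cyclic_flats. C \<inter> X F \<noteq> {}}"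
    have "finite T" using finite_cyclic_flats by (simp add: T_def)
    moreover have "C \<noteq> {}" using C(1) indep_empty by (auto simp: circuit_def)
    then have "T \<noteq> {}" using C(2) by (fastforce simp: T_def B_def)
    ultimately obtain F where F: "F \<in> T" and F_max: "\<And>Y. Y \<in> T \<Longrightarrow> F \<subseteq> Y \<Longrightarrow> F = Y"
      using finite_has_maximal[of T] by blast
    then have Ff: "F \<in> cyclic_flats" by (simp add: T_def)
    \<comment> \<open>By maximality of \<open>F\<close> every other \<open>X Y\<close> met by \<open>C\<close> lies in \<open>F\<close>.\<close>
    have C_sub: "C \<subseteq> F \<union> X F"
    proof
      fix c assume c: "c \<in> C"
      then obtain Y where Y: "Y \<in> cyclic_flats" "c \<in> X Y" using C(2) by (auto simp: B_def)
      then have "Y \<in> T" using c by (auto simp: T_def)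
      then have "Y = F \<or> \<not> F \<subseteq> Y" using F_max by blast
      then show "c \<in> F \<union> X F" using X_sub[OF Y(1) Ff] Y(2) by blast
    qed
    obtain x where x: "x \<in> C" "x \<in> X F" using F by (auto simp: T_def)
    \<comment> \<open>The circuit makes \<open>x\<close> redundant in \<open>F \<union> X F\<close>,
      whereas every element of \<open>X F\<close> has to contribute to the rank over
      \<open>F\<close>.\<close>
    have "x \<in> span (C - {x})" using circuit_in_span[OF C(1) x(1)] .
    moreover have "C - {x} \<subseteq> F \<union> (X F - {x})" using C_sub by blast
    ultimately have "x \<in> span (F \<union> (X F - {x}))" using span_mono by blast
    then have "rank (insert x (F \<union> (X F - {x}))) = rank (F \<union> (X F - {x}))"
      by (simp add: span_def)
    moreover have "insert x (F \<union> (X F - {x})) = F \<union> X F" using x(2) by blast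
    moreover have "rank (F \<union> (X F - {x})) \<le> rank F + card (X F - {x})"
      using rank_submodular[of F "X F - {x}"] rank_le_card[of "X F - {x}"] finX[OF Ff] by simp
    moreover have "card (X F - {x}) < card (X F)"
      using finX[OF Ff] x(2) by (rule card_Diff1_less)
    ultimately show False using rank_X[OF Ff] by simp
  qed
  \<comment> \<open>For the filter of all cyclic flats, the intersection lies in
    \<open>span {}\<close>, the least cyclic flat, which has rank 0.\<close>
  have total: "(\<Sum>F\<in>cyclic_flats. beta F) = int (rank E)"
  proof -
    have "cyclic {}" by (simp add: cyclic_iff)
    then have "span {} \<in> cyclic_flats" by (rule span_cyclic)
    then have "rank (E \<inter> \<Inter>cyclic_flats) \<le> rank (span {})" by (intro rank_mono) blast
    also have "\<dots> = 0" using rank_span[of "{}"] rank_le_card[of "{}"] by simp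
    finally show ?thesis using eq[of cyclic_flats] by (simp add: cyclic_flats_filter_def)
  qed
  have "card B = rank E" using card_UN[of cyclic_flats] total by (simp add: B_def)
  moreover have "F \<subseteq> span (B \<inter> F)" if F: "F \<in> cyclic_flats" for F
  proof (rule subset_span_if_rank_le)
    \<comment> \<open>\<open>X Y\<close> lies in \<open>F\<close> if \<open>F \<subseteq> Y\<close>
      fails, and misses \<open>F\<close> otherwise. So \<open>card (B \<inter> F)\<close> is the
      total of \<open>beta\<close> minus its sum over the principal filter of \<open>F\<close>, that
      is, \<open>rank F\<close>.\<close>
    define T where "T = {Y \<in> cyclic_flats. \<not> F \<subseteq> Y}"
    have "B \<inter> F = (\<Union>Y\<in>T. X Y)"
    proof
      show "B \<inter> F \<subseteq> (\<Union>Y\<in>T. X Y)" using X_disj by (fastforce simp: B_def T_def)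
      show "(\<Union>Y\<in>T. X Y) \<subseteq> B \<inter> F" using X_sub[OF _ F] by (fastforce simp: B_def T_def)
    qed
    then have "int (card (B \<inter> F)) = (\<Sum>Y\<in>T. beta Y)" using card_UN[of T] by (simp add: T_def)
    moreover have "(\<Sum>Y\<in>cyclic_flats. beta Y)
        = (\<Sum>Y\<in>{Y \<in> cyclic_flats. F \<subseteq> Y}. beta Y) + (\<Sum>Y\<in>T. beta Y)"
      using finite_cyclic_flats unfolding T_def
      by (subst sum.union_disjoint[symmetric]) (auto intro: sum.cong)
    ultimately have "card (B \<inter> F) = rank F" using total sum_beta_supersets[OF F] by simp
    moreover have "indep (B \<inter> F)" using indep_B by (rule indep_mono) blast
    ultimately show "rank F \<le> rank (B \<inter> F)" by (simp add: rank_indep)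
    show "F \<subseteq> E" using F by (rule cyclic_flats_subset_ground)
  qed blast
  ultimately show ?thesis using indep_B unfolding fundamental_basis_def by blast
qed

end

theorem theorem4p4:
  fixes E :: "'a set" and indep :: "'a set \<Rightarrow> bool"
  assumes "matroid E indep"
  shows "matroid.fundamental_transversal E indep \<longleftrightarrow>
    (\<forall>\<F>. matroid.cyclic_flats_filter E indep \<F> \<longrightarrow>
      (\<Sum>Y\<in>\<F>. matroid.beta E indep Y) =
        int (matroid.rank indep E) - int (matroid.rank indep (E \<inter> \<Inter>\<F>)))"
proof -
  interpret matroid E indep by (rule assms)
  show ?thesis
    using fundamental_transversal_imp_basis fundamental_transversalI_basis
      fundamental_basis_imp_sum_beta sum_beta_imp_fundamental_basis by metis
qed

end
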